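(* Let $w$ be a binary word and let $m,n\in\mathbf N$. (a) Assume $n\ge1$. Then $\zeta(w0)_{m,n}=n^{-1}\zeta(w)_{m,n}$ if $m\ge1$ or $w\notin{}_1\mathrm W$; and $\zeta(w1)_{m,n-1}=\zeta(w1)_{m,n}+n^{-1}\zeta(w)_{m,n}$ if $m\ge1$ or $w\in{}_0\mathrm W$. (b) Assume $m\ge1$. Then $\zeta(1w)_{m,n}=m^{-1}\zeta(w)_{m,n}$ if $n\ge1$ or $w\notin\mathrm W_0$; and $\zeta(0w)_{m-1,n}=\zeta(0w)_{m,n}+m^{-1}\zeta(w)_{m,n}$ if $n\ge1$ or $w\in\mathrm W_1$. (Here $w0$, $w1$, $0w$, $1w$ denote concatenations.)
   Context: $\mathbf N$ is the set of non-negative integers. A binary word is a finite word $w=\varepsilon_1\ldots\varepsilon_k$ over $\{0,1\}$ (possibly empty, written $\varnothing$). ${}_0\mathrm W$, ${}_1\mathrm W$ denote the sets of binary words starting with $0$, resp. $1$; $\mathrm W_0$, $\mathrm W_1$ those ending with $0$, resp. $1$. Set $f_0(t)=1/t$, $f_1(t)=1/(1-t)$. For a binary word $w=\varepsilon_1\ldots\varepsilon_k$ and $m,n\in\mathbf N$ with $m\ge1$ if $w\in{}_1\mathrm W$ and $n\ge1$ if $w\in\mathrm W_0$, define $$\zeta(w)_{m,n}=\int_{1>t_1>\cdots>t_k>0}(1-t_1)^m f_{\varepsilon_1}(t_1)\cdots f_{\varepsilon_k}(t_k)\,t_k^n\,dt_1\cdots dt_k\quad(k\ge1),$$ so that for $k=1$: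 $\zeta(0)_{m,n}=\int_0^1(1-t)^mt^{n-1}dt=\frac{m!(n-1)!}{(m+n)!}$, $\zeta(1)_{m,n}=\int_0^1(1-t)^{m-1}t^{n}dt=\frac{(m-1)!n!}{(m+n)!}$; and $\zeta(\varnothing)_{m,n}=\frac{m!\,n!}{(m+n)!}$. These integrals converge. *)

theory Defs
  imports "HOL-Analysis.Analysis" "HOL-Library.Z2"
begin

text \<open>Binary words \<open>\<epsilon>\<^sub>1\<dots>\<epsilon>\<^sub>k\<close> are lists over the two-element type \<^typ>\<open>bit\<close>; only its two constants
  are used, not its arithmetic. Indices are shifted to start at \<open>0\<close>: \<open>t\<^sub>i\<close> is \<open>t (i - 1)\<close>.\<close>

type_synonym binary_word = "bit list"

definition words_starting :: "bit \<Rightarrow> binary_word set" where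
  "words_starting e = {w. w \<noteq> [] \<and> hd w = e}"

definition words_ending :: "bit \<Rightarrow> binary_word set" where
  "words_ending e = {w. w \<noteq> [] \<and> last w = e}"

definition ff :: "bit \<Rightarrow> real \<Rightarrow> real" where
  "ff e t = (if e = 0 then 1 / t else 1 / (1 - t))"

text \<open>The open simplex \<open>1 > t\<^sub>1 > \<dots> > t\<^sub>k > 0\<close>, for \<open>k \<ge> 1\<close>.\<close>

definition open_simplex :: "nat \<Rightarrow> (nat \<Rightarrow> real) set" where
  "open_simplex k =
     {t \<in> {..<k} \<rightarrow>\<^sub>E UNIV. 1 > t 0 \<and> (\<forall>i. Suc i < k \<longrightarrow> t i > t (Suc i)) \<and> t (k - 1) > 0}"

text \<open>The value is meaningful when \<open>m \<ge> 1\<close> or \<open>w \<notin> words_starting 1\<close>, and \<open>n \<ge> 1\<close> or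
  \<open>w \<notin> words_ending 0\<close>; outside this range the integral may diverge.\<close>

definition zeta :: "binary_word \<Rightarrow> nat \<Rightarrow> nat \<Rightarrow> real" where
  "zeta w m n =
     (if w = [] then fact m * fact n / fact (m + n)
      else (LINT t : open_simplex (length w) | (\<Pi>\<^sub>M i\<in>{..<length w}. lborel).
              (1 - t 0) ^ m * (\<Prod>i<length w. ff (w ! i) (t i)) * t (length w - 1) ^ n))"

end

theory Submission
  imports Defs
begin

text \<open>Replace \<open>(1 - t\<^sub>1)\<^sup>m\<close> and \<open>t\<^sub>k\<^sup>n\<close> by arbitrary weights \<open>h(t\<^sub>1)\<close> and \<open>g(t\<^sub>k)\<close>, and take integrals in
  \<open>[0, \<infinity>]\<close>. By Tonelli, integrating out the innermost variable removes the last letter \<open>\<epsilon>\<close> of the word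
  and replaces \<open>g\<close> by \<open>x \<mapsto> \<integral>\<^sub>0\<^sup>x f\<^sub>\<epsilon> g\<close>; integrating out the outermost one removes the first letter
  and replaces \<open>h\<close> by \<open>x \<mapsto> \<integral>\<^sub>x\<^sup>1 f\<^sub>\<epsilon> h\<close>. The relations then come from \<open>1 / (1 - t) = 1 + t / (1 - t)\<close>
  and \<open>\<integral>\<^sub>0\<^sup>x t\<^sup>n\<^sup>-\<^sup>1 dt = x\<^sup>n / n\<close>, and their mirror images under \<open>t \<mapsto> 1 - t\<close>.
  They hold in \<open>[0, \<infinity>]\<close> without any convergence hypothesis. Passing to real numbers requires finiteness,
  which for \<open>m, n \<ge> 1\<close> is a domination argument and in the boundary cases \<open>m = 0\<close> or \<open>n = 0\<close> follows
  from the relations themselves, whose right-hand sides have exponents at least \<open>1\<close>.\<close>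

section \<open>Weighted simplex integrals and the reflection of the unit interval\<close>

definition lower_int :: "bit \<Rightarrow> (real \<Rightarrow> ennreal) \<Rightarrow> real \<Rightarrow> ennreal" where
  "lower_int e g x = (\<integral>\<^sup>+y. ennreal (ff e y) * g y * indicator {0<..<x} y \<partial>lborel)"

definition upper_int :: "bit \<Rightarrow> (real \<Rightarrow> ennreal) \<Rightarrow> real \<Rightarrow> ennreal" where
  "upper_int e h x = (\<integral>\<^sup>+y. ennreal (ff e y) * h y * indicator {x<..<1} y \<partial>lborel)"

text \<open>General weights keep the family closed under integrating out an end variable, which a
  power weight would not. Only \<open>w \<noteq> []\<close> is meaningful: otherwise
  \<open>t 0\<close> and \<open>t (length w - 1)\<close> are no coordinates of the product
  space.\<close>

definition simplex_int ::
    "binary_word \<Rightarrow> (real \<Rightarrow> ennreal) \<Rightarrow> (real \<Rightarrow> ennreal) \<Rightarrow> ennreal" where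
  "simplex_int w h g =
     (\<integral>\<^sup>+t. h (t 0) * (\<Prod>i<length w. ennreal (ff (w ! i) (t i))) * g (t (length w - 1)) *
        indicator (open_simplex (length w)) t \<partial>(\<Pi>\<^sub>M i\<in>{..<length w}. lborel))"

abbreviation lower_weight :: "nat \<Rightarrow> real \<Rightarrow> ennreal" where
  "lower_weight n \<equiv> \<lambda>t. ennreal (t ^ n)"

abbreviation upper_weight :: "nat \<Rightarrow> real \<Rightarrow> ennreal" where
  "upper_weight m \<equiv> \<lambda>t. ennreal ((1 - t) ^ m)"

lemma ff_measurable [measurable]: "ff e \<in> borel_measurable borel"
  unfolding ff_def by measurable

lemma ff_nonneg: "0 < t \<Longrightarrow> t < 1 \<Longrightarrow> 0 \<le> ff e t"
  by (simp add: ff_def)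

text \<open>Addition in \<open>bit\<close> is modulo 2, so \<open>e + 1\<close> is the other letter.
  This symmetry carries statements about the innermost variable over to the outermost one.\<close>

lemma ff_reflect: "ff (e + 1) (1 - t) = ff e t"
  by (cases e) (simp_all add: ff_def)

lemma lower_int_measurable [measurable]:
  assumes [measurable]: "g \<in> borel_measurable borel"
  shows "lower_int e g \<in> borel_measurable borel"
proof -
  \<comment> \<open>The indicator of an interval depending on \<open>x\<close> becomes a condition
    on the pair \<open>(x, y)\<close>, so that joint measurability of the integrand is
    visible.\<close>
  have "lower_int e g =
      (\<lambda>x. \<integral>\<^sup>+y. ennreal (ff e y) * g y * (if 0 < y \<and> y < x then 1 else 0) \<partial>lborel)"
    unfolding lower_int_def by (intro ext nn_integral_cong) (auto simp: indicator_def)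
  also have "\<dots> \<in> borel_measurable borel"
    by measurable
  finally show ?thesis .
qed

text \<open>Substitution of \<open>1 - y\<close> for \<open>y\<close>; every fact about
  \<open>upper_int\<close> below on measurability or on power weights is obtained from
  \<open>lower_int\<close> this way.\<close>

lemma upper_int_eq_lower_int:
  assumes [measurable]: "h \<in> borel_measurable borel"
  shows "upper_int e h x = lower_int (e + 1) (\<lambda>t. h (1 - t)) (1 - x)"
proof -
  have "upper_int e h x = (\<integral>\<^sup>+y. ennreal (ff e (1 + (- 1) * y)) * h (1 + (- 1) * y) *
      indicator {x<..<1} (1 + (- 1) * y) \<partial>lborel)"
    unfolding upper_int_def by (subst nn_integral_real_affine[where c = "- 1" and t = 1]) auto
  also have "\<dots> = lower_int (e + 1) (\<lambda>t. h (1 - t)) (1 - x)"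
    unfolding lower_int_def
  proof (intro nn_integral_cong)
    fix y :: real
    have "ff e (1 - y) = ff (e + 1) y"
      using ff_reflect[of e "1 - y"] by simp
    then show "ennreal (ff e (1 + (- 1) * y)) * h (1 + (- 1) * y) *
        indicator {x<..<1} (1 + (- 1) * y)
      = ennreal (ff (e + 1) y) * h (1 - y) * indicator {0<..<1 - x} y"
      by (auto simp: indicator_def)
  qed
  finally show ?thesis .
qed

lemma upper_int_measurable [measurable]:
  assumes [measurable]: "h \<in> borel_measurable borel"
  shows "upper_int e h \<in> borel_measurable borel"
proof -
  have "upper_int e h = (\<lambda>x. lower_int (e + 1) (\<lambda>t. h (1 - t)) (1 - x))"
    by (intro ext upper_int_eq_lower_int) fact
  also have "\<dots> \<in> borel_measurable borel"
    by measurable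
  finally show ?thesis .
qed

section \<open>One-variable integrals of power weights\<close>

lemma nn_integral_power_Ioo:
  assumes "0 < x"
  shows "(\<integral>\<^sup>+y. ennreal (y ^ n) * indicator {0<..<x} y \<partial>lborel) = ennreal (x ^ Suc n / Suc n)"
proof -
  have "((\<lambda>y. y ^ n) has_integral (x ^ Suc n / Suc n - 0 ^ Suc n / Suc n)) {0..x}"
  proof (rule fundamental_theorem_of_calculus)
    fix y :: real
    have "((\<lambda>y. y ^ Suc n / Suc n) has_real_derivative Suc n * y ^ (Suc n - Suc 0) / Suc n)
        (at y within {0..x})"
      by (intro DERIV_cdivide DERIV_pow)
    then show "((\<lambda>y. y ^ Suc n / Suc n) has_vector_derivative y ^ n) (at y within {0..x})"
      by (simp add: has_real_derivative_iff_has_vector_derivative del: of_nat_Suc power_Suc)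
  qed (use assms in simp)
  then have "((\<lambda>y. y ^ n) has_integral (x ^ Suc n / Suc n)) {0<..<x}"
    by (simp add: has_integral_Icc_iff_Ioo)
  then show ?thesis
    by (intro nn_integral_has_integral_lebesgue') auto
qed

text \<open>The pole \<open>1 / t\<close> cancels one power of \<open>t\<close>, hence the successor
  exponent.\<close>

lemma lower_int_0_power:
  assumes "0 < x"
  shows "lower_int 0 (lower_weight (Suc n)) x = ennreal (1 / Suc n) * lower_weight (Suc n) x"
proof -
  have "lower_int 0 (lower_weight (Suc n)) x =
      (\<integral>\<^sup>+y. ennreal (y ^ n) * indicator {0<..<x} y \<partial>lborel)"
    unfolding lower_int_def
    by (intro nn_integral_cong) (auto simp: indicator_def ff_def ennreal_mult[symmetric])
  also have "\<dots> = ennreal (1 / Suc n) * lower_weight (Suc n) x"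
    using assms by (simp add: nn_integral_power_Ioo ennreal_mult[symmetric] del: power_Suc of_nat_Suc)
  finally show ?thesis .
qed

text \<open>Multiply \<open>1 / (1 - y) = y / (1 - y) + 1\<close> by \<open>y ^ n\<close> and
  integrate; all terms are nonnegative, so the sum splits even in [0, \<infinity>].\<close>

lemma lower_int_1_power:
  assumes "0 < x" "x < 1"
  shows "lower_int 1 (lower_weight n) x =
    lower_int 1 (lower_weight (Suc n)) x + ennreal (1 / Suc n) * lower_weight (Suc n) x"
proof -
  have eq: "ennreal (ff 1 y) * lower_weight n y =
      ennreal (ff 1 y) * lower_weight (Suc n) y + ennreal (y ^ n)"
    if "0 < y" "y < x" for y
  proof -
    have "ff 1 y * y ^ n = ff 1 y * y ^ Suc n + y ^ n"
      using that assms by (simp add: ff_def field_simps)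
    then show ?thesis
      using that assms
      by (simp add: ff_nonneg ennreal_mult[symmetric] ennreal_plus[symmetric]
          del: ennreal_plus power_Suc)
  qed
  have "lower_int 1 (lower_weight n) x =
      (\<integral>\<^sup>+y. ennreal (ff 1 y) * lower_weight (Suc n) y * indicator {0<..<x} y +
         ennreal (y ^ n) * indicator {0<..<x} y \<partial>lborel)"
    unfolding lower_int_def
    by (intro nn_integral_cong) (auto simp: indicator_def eq)
  also have "\<dots> = lower_int 1 (lower_weight (Suc n)) x +
      (\<integral>\<^sup>+y. ennreal (y ^ n) * indicator {0<..<x} y \<partial>lborel)"
    unfolding lower_int_def by (subst nn_integral_add) auto
  also have "(\<integral>\<^sup>+y. ennreal (y ^ n) * indicator {0<..<x} y \<partial>lborel) =
      ennreal (1 / Suc n) * lower_weight (Suc n) x"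
    using assms by (simp add: nn_integral_power_Ioo ennreal_mult[symmetric] del: power_Suc of_nat_Suc)
  finally show ?thesis .
qed

text \<open>Mirror image of \<open>lower_int_0_power\<close>, read at \<open>1 - x\<close>, since
  \<open>1 + 1 = 0\<close> in \<open>bit\<close>.\<close>

lemma upper_int_1_power:
  assumes "x < 1"
  shows "upper_int 1 (upper_weight (Suc m)) x = ennreal (1 / Suc m) * upper_weight (Suc m) x"
  using lower_int_0_power[of "1 - x" m] assms
  by (simp add: upper_int_eq_lower_int del: power_Suc of_nat_Suc)

lemma upper_int_0_power:
  assumes "0 < x" "x < 1"
  shows "upper_int 0 (upper_weight m) x =
    upper_int 0 (upper_weight (Suc m)) x + ennreal (1 / Suc m) * upper_weight (Suc m) x"
  using lower_int_1_power[of "1 - x" m] assms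
  by (simp add: upper_int_eq_lower_int del: power_Suc of_nat_Suc)

section \<open>Bounds on the simplex and measurability\<close>

lemma open_simplex_antimono:
  assumes "t \<in> open_simplex k" "i \<le> j" "j < k"
  shows "t j \<le> t i"
  using assms(2,3)
proof (induction j rule: dec_induct)
  case (step j)
  then have "t (Suc j) < t j"
    using assms(1) by (simp add: open_simplex_def)
  with step show ?case by simp
qed simp

lemma open_simplex_bounds:
  assumes "t \<in> open_simplex k" "i < k"
  shows "t i \<le> t 0" "t (k - 1) \<le> t i" "0 < t i" "t i < 1"
proof -
  show "t i \<le> t 0" "t (k - 1) \<le> t i"
    using open_simplex_antimono[OF assms(1)] assms(2) by simp_all
  moreover have "0 < t (k - 1)" "t 0 < 1"
    using assms(1) by (simp_all add: open_simplex_def)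
  ultimately show "0 < t i" "t i < 1"
    by simp_all
qed

lemma open_simplex_measurable [measurable]:
  assumes "0 < k"
  shows "open_simplex k \<in> sets (\<Pi>\<^sub>M i\<in>{..<k}. (lborel :: real measure))"
proof -
  let ?M = "\<Pi>\<^sub>M i\<in>{..<k}. (lborel :: real measure)"
  have [measurable]: "(\<lambda>t. t i) \<in> borel_measurable ?M" if "i < k" for i
    using measurable_component_singleton[of i "{..<k}" "\<lambda>_. lborel :: real measure"] that by simp
  \<comment> \<open>Finitely many inequalities between coordinates; \<open>k > 0\<close> makes
    \<open>0\<close> and \<open>k - 1\<close> genuine indices.\<close>
  have "open_simplex k = {t \<in> space ?M. t 0 < 1} \<inter>
      {t \<in> space ?M. \<forall>i\<in>{..<k - 1}. t (Suc i) < t i} \<inter> {t \<in> space ?M. 0 < t (k - 1)}"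
    by (auto simp: open_simplex_def space_PiM less_diff_conv)
  also have "\<dots> \<in> sets ?M"
  proof (intro sets.Int)
    show "{t \<in> space ?M. t 0 < 1} \<in> sets ?M" "{t \<in> space ?M. 0 < t (k - 1)} \<in> sets ?M"
      using assms by (measurable, simp_all)
    show "{t \<in> space ?M. \<forall>i\<in>{..<k - 1}. t (Suc i) < t i} \<in> sets ?M"
    proof (rule sets.sets_Collect_finite_All)
      fix i assume "i \<in> {..<k - 1}"
      then have [measurable]: "(\<lambda>t. t i) \<in> borel_measurable ?M"
        "(\<lambda>t. t (Suc i)) \<in> borel_measurable ?M"
        by auto
      show "{t \<in> space ?M. t (Suc i) < t i} \<in> sets ?M"
        by measurable
    qed simp
  qed
  finally show ?thesis .
qed

lemma simplex_integrand_measurable: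
  assumes [measurable]: "h \<in> borel_measurable borel" "g \<in> borel_measurable borel" and "w \<noteq> []"
  shows "(\<lambda>t. h (t 0) * (\<Prod>i<length w. ennreal (ff (w ! i) (t i))) * g (t (length w - 1)) *
      indicator (open_simplex (length w)) t)
    \<in> borel_measurable (\<Pi>\<^sub>M i\<in>{..<length w}. (lborel :: real measure))"
proof -
  let ?M = "\<Pi>\<^sub>M i\<in>{..<length w}. (lborel :: real measure)"
  have comp [measurable]: "(\<lambda>t. t i) \<in> borel_measurable ?M" if "i < length w" for i
    using measurable_component_singleton[of i "{..<length w}" "\<lambda>_. lborel :: real measure"] that
    by simp
  have pos: "0 < length w" "length w - 1 < length w"
    using assms(3) by simp_all
  have [measurable]: "(\<lambda>t. ennreal (ff (w ! i) (t i))) \<in> borel_measurable ?M" if "i \<in> {..<length w}" for i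
  proof -
    have [measurable]: "(\<lambda>t. t i) \<in> borel_measurable ?M"
      using comp that by simp
    show ?thesis
      by measurable
  qed
  note comp[OF pos(1), measurable] comp[OF pos(2), measurable]
    open_simplex_measurable[OF pos(1), measurable]
  show ?thesis
    by measurable
qed

section \<open>Dependence of the simplex integral on its weights\<close>

text \<open>Both weights are evaluated at coordinates of a point of the simplex, which lie strictly
  between 0 and 1. This is what allows the power formulas, valid only there, to be inserted.\<close>

lemma simplex_int_cong:
  assumes "\<And>t. 0 < t \<Longrightarrow> t < 1 \<Longrightarrow> h t = h' t" "\<And>t. 0 < t \<Longrightarrow> t < 1 \<Longrightarrow> g t = g' t" "w \<noteq> []"
  shows "simplex_int w h g = simplex_int w h' g'"
  unfolding simplex_int_def
proof (intro nn_integral_cong)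
  fix t :: "nat \<Rightarrow> real"
  show "h (t 0) * (\<Prod>i<length w. ennreal (ff (w ! i) (t i))) * g (t (length w - 1)) *
        indicator (open_simplex (length w)) t =
      h' (t 0) * (\<Prod>i<length w. ennreal (ff (w ! i) (t i))) * g' (t (length w - 1)) *
        indicator (open_simplex (length w)) t"
    using assms open_simplex_bounds[of t "length w" 0]
      open_simplex_bounds[of t "length w" "length w - 1"]
    by (cases "t \<in> open_simplex (length w)") auto
qed

text \<open>Sum and scalar multiple are combined in the shape of the additive relation; a zero first
  summand leaves homogeneity alone.\<close>

lemma simplex_int_add_right:
  assumes [measurable]: "h \<in> borel_measurable borel" "g \<in> borel_measurable borel"
    "g' \<in> borel_measurable borel" and "w \<noteq> []"
  shows "simplex_int w h (\<lambda>t. g t + c * g' t) = simplex_int w h g + c * simplex_int w h g'"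
  unfolding simplex_int_def using assms
  by (simp add: distrib_left distrib_right nn_integral_add simplex_integrand_measurable
      nn_integral_cmult[symmetric] mult_ac)

lemma simplex_int_cmult_right:
  assumes [measurable]: "h \<in> borel_measurable borel" "g \<in> borel_measurable borel" and "w \<noteq> []"
  shows "simplex_int w h (\<lambda>t. c * g t) = c * simplex_int w h g"
  using simplex_int_add_right[of h "\<lambda>_. 0" g w c] assms by (simp add: simplex_int_def)

lemma simplex_int_add_left:
  assumes [measurable]: "g \<in> borel_measurable borel" "h \<in> borel_measurable borel"
    "h' \<in> borel_measurable borel" and "w \<noteq> []"
  shows "simplex_int w (\<lambda>t. h t + c * h' t) g = simplex_int w h g + c * simplex_int w h' g"
  unfolding simplex_int_def using assms
  by (simp add: distrib_left distrib_right nn_integral_add simplex_integrand_measurable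
      nn_integral_cmult[symmetric] mult_ac)

lemma simplex_int_cmult_left:
  assumes [measurable]: "g \<in> borel_measurable borel" "h \<in> borel_measurable borel" and "w \<noteq> []"
  shows "simplex_int w (\<lambda>t. c * h t) g = c * simplex_int w h g"
  using simplex_int_add_left[of g "\<lambda>_. 0" h w c] assms by (simp add: simplex_int_def)

section \<open>Removing the last or the first letter by Tonelli\<close>

lemma product_sigma_finite_lborel: "product_sigma_finite (\<lambda>_. lborel :: real measure)"
  by (intro product_sigma_finite.intro sigma_finite_lborel)

text \<open>With one letter, both weights fall on the same variable.\<close>

lemma simplex_int_single:
  assumes [measurable]: "h \<in> borel_measurable borel" "g \<in> borel_measurable borel"
  shows "simplex_int [e] h g =
    (\<integral>\<^sup>+y. h y * ennreal (ff e y) * g y * indicator {0<..<1} y \<partial>lborel)"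
proof -
  interpret product_sigma_finite "\<lambda>_. lborel :: real measure"
    by (rule product_sigma_finite_lborel)
  have "simplex_int [e] h g = (\<integral>\<^sup>+t. (\<lambda>y. h y * ennreal (ff e y) * g y * indicator {0<..<1} y) (t 0)
      \<partial>(\<Pi>\<^sub>M i\<in>{0::nat}. lborel))"
    unfolding simplex_int_def
    by (simp add: lessThan_Suc, rule nn_integral_cong)
       (auto simp: indicator_def open_simplex_def space_PiM lessThan_Suc)
  also have "\<dots> = (\<integral>\<^sup>+y. h y * ennreal (ff e y) * g y * indicator {0<..<1} y \<partial>lborel)"
    by (rule product_nn_integral_singleton) measurable
  finally show ?thesis .
qed

text \<open>The fibre of the larger simplex over a point of the smaller one is the interval from
  \<open>0\<close> to \<open>t (k - 1)\<close>, the domain of integration in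
  \<open>lower_int\<close>.\<close>

lemma open_simplex_Suc_iff:
  assumes "t \<in> {..<k} \<rightarrow>\<^sub>E UNIV" "0 < k"
  shows "t(k := y) \<in> open_simplex (Suc k) \<longleftrightarrow> t \<in> open_simplex k \<and> 0 < y \<and> y < t (k - 1)"
proof
  assume L: "t(k := y) \<in> open_simplex (Suc k)"
  have step: "(t(k := y)) (Suc i) < (t(k := y)) i" if "i < k" for i
    using L that by (simp add: open_simplex_def)
  have "t (Suc i) < t i" if "Suc i < k" for i
    using step[of i] that by simp
  moreover have "y < t (k - 1)"
    using step[of "k - 1"] assms(2) by (cases k) auto
  ultimately show "t \<in> open_simplex k \<and> 0 < y \<and> y < t (k - 1)"
    using L assms by (simp add: open_simplex_def)
next
  assume R: "t \<in> open_simplex k \<and> 0 < y \<and> y < t (k - 1)"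
  have "(t(k := y)) (Suc i) < (t(k := y)) i" if "i < k" for i
  proof (cases "Suc i = k")
    case True
    then show ?thesis using R by auto
  next
    case False
    then show ?thesis using R that by (simp add: open_simplex_def)
  qed
  moreover have "t(k := y) \<in> {..<Suc k} \<rightarrow>\<^sub>E UNIV"
    using assms(1) by (auto simp: PiE_def extensional_def)
  ultimately show "t(k := y) \<in> open_simplex (Suc k)"
    using R assms(2) by (simp add: open_simplex_def)
qed

lemma simplex_int_snoc:
  assumes [measurable]: "h \<in> borel_measurable borel" "g \<in> borel_measurable borel" and "w \<noteq> []"
  shows "simplex_int (w @ [e]) h g = simplex_int w h (lower_int e g)"
proof -
  interpret product_sigma_finite "\<lambda>_. lborel :: real measure"
    by (rule product_sigma_finite_lborel)
  let ?k = "length w"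
  define F where "F = (\<lambda>t. h (t 0) * (\<Prod>i<Suc ?k. ennreal (ff ((w @ [e]) ! i) (t i))) * g (t ?k) *
      indicator (open_simplex (Suc ?k)) t)"
  define G where "G = (\<lambda>t. h (t 0) * (\<Prod>i<?k. ennreal (ff (w ! i) (t i))) *
      indicator (open_simplex ?k) t)"
  have k: "0 < ?k"
    using assms(3) by simp
  have F_meas: "F \<in> borel_measurable (\<Pi>\<^sub>M i\<in>insert ?k {..<?k}. lborel)"
    using simplex_integrand_measurable[of h g "w @ [e]"]
    by (simp add: F_def lessThan_Suc)
  \<comment> \<open>The factor \<open>G t\<close> is free of \<open>y\<close>, so the inner integral
    only sees the new letter, the weight \<open>g\<close> and the fibre.\<close>
  have F_eq: "F (t(?k := y)) = G t * (ennreal (ff e y) * g y * indicator {0<..<t (?k - 1)} y)"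
    if "t \<in> {..<?k} \<rightarrow>\<^sub>E UNIV" for t y
  proof -
    have "(\<Prod>i<?k. ennreal (ff ((w @ [e]) ! i) ((t(?k := y)) i))) =
        (\<Prod>i<?k. ennreal (ff (w ! i) (t i)))"
      by (intro prod.cong) (auto simp: nth_append)
    moreover have "indicator (open_simplex (Suc ?k)) (t(?k := y)) =
        (indicator (open_simplex ?k) t * indicator {0<..<t (?k - 1)} y :: ennreal)"
      using open_simplex_Suc_iff[OF that k] by (auto simp: indicator_def)
    ultimately show ?thesis
      using k by (simp add: F_def G_def mult_ac)
  qed
  have "simplex_int (w @ [e]) h g = (\<integral>\<^sup>+t. F t \<partial>(\<Pi>\<^sub>M i\<in>insert ?k {..<?k}. lborel))"
    by (simp add: simplex_int_def F_def lessThan_Suc)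
  also have "\<dots> = (\<integral>\<^sup>+t. (\<integral>\<^sup>+y. F (t(?k := y)) \<partial>lborel) \<partial>(\<Pi>\<^sub>M i\<in>{..<?k}. lborel))"
    by (intro product_nn_integral_insert F_meas) auto
  also have "\<dots> = (\<integral>\<^sup>+t. G t * lower_int e g (t (?k - 1)) \<partial>(\<Pi>\<^sub>M i\<in>{..<?k}. lborel))"
    unfolding lower_int_def
    by (intro nn_integral_cong) (simp add: space_PiM F_eq nn_integral_cmult)
  also have "\<dots> = simplex_int w h (lower_int e g)"
    by (simp add: simplex_int_def G_def mult_ac)
  finally show ?thesis .
qed

text \<open>Splitting off coordinate 0 directly would shift all other indices. Induction from the
  right end avoids this: only words of two letters need an exchange of integrals, and longer ones
  reduce through \<open>simplex_int_snoc\<close>.\<close>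

lemma simplex_int_Cons:
  assumes "h \<in> borel_measurable borel" "g \<in> borel_measurable borel" and "w \<noteq> []"
  shows "simplex_int (e # w) h g = simplex_int w (upper_int e h) g"
  using assms(3,1,2)
proof (induction w arbitrary: g rule: rev_nonempty_induct)
  case (single d)
  note [measurable] = single.prems
  \<comment> \<open>The triangle \<open>0 < y < x < 1\<close> is written as one condition, so that
    either variable can be integrated first.\<close>
  let ?f = "\<lambda>x y. h x * ennreal (ff e x) * (ennreal (ff d y) * g y) *
    (if 0 < y \<and> y < x \<and> x < 1 then 1 else 0)"
  have "simplex_int [e, d] h g = simplex_int [e] h (lower_int d g)"
    using simplex_int_snoc[of h g "[e]" d] by simp
  also have "\<dots> = (\<integral>\<^sup>+x. h x * ennreal (ff e x) * indicator {0<..<1} x * lower_int d g x \<partial>lborel)"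
    by (subst simplex_int_single) (auto simp: mult_ac)
  also have "\<dots> = (\<integral>\<^sup>+x. \<integral>\<^sup>+y. ?f x y \<partial>lborel \<partial>lborel)"
    unfolding lower_int_def
    by (subst nn_integral_cmult[symmetric])
       (auto simp: indicator_def mult_ac intro!: nn_integral_cong)
  also have "\<dots> = (\<integral>\<^sup>+y. \<integral>\<^sup>+x. ?f x y \<partial>lborel \<partial>lborel)"
    by (intro lborel_pair.Fubini') measurable
  also have "\<dots> = (\<integral>\<^sup>+y. ennreal (ff d y) * g y * indicator {0<..<1} y * upper_int e h y \<partial>lborel)"
    unfolding upper_int_def
    by (subst nn_integral_cmult[symmetric])
       (auto simp: indicator_def mult_ac intro!: nn_integral_cong)
  also have "\<dots> = simplex_int [d] (upper_int e h) g"
    by (subst simplex_int_single) (auto simp: mult_ac)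
  finally show ?case .
next
  case (snoc d w)
  note [measurable] = snoc.prems
  show ?case
    \<comment> \<open>Both sides lose the letter \<open>d\<close>, which turns \<open>g\<close> into
      \<open>lower_int d g\<close>; hence the induction is over arbitrary \<open>g\<close>.\<close>
    using simplex_int_snoc[of h g "e # w" d] simplex_int_snoc[of "upper_int e h" g w d]
      snoc.IH[of "lower_int d g"] snoc.hyps
    by simp
qed

section \<open>From [0, \<infinity>]-valued integrals to \<open>zeta\<close>\<close>

lemma simplex_integrand_eq_ennreal:
  assumes "w \<noteq> []"
  shows "upper_weight m (t 0) * (\<Prod>i<length w. ennreal (ff (w ! i) (t i))) *
      lower_weight n (t (length w - 1)) * indicator (open_simplex (length w)) t =
    ennreal (indicator (open_simplex (length w)) t *
      ((1 - t 0) ^ m * (\<Prod>i<length w. ff (w ! i) (t i)) * t (length w - 1) ^ n))"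
proof (cases "t \<in> open_simplex (length w)")
  case True
  have b: "0 < t i" "t i < 1" if "i < length w" for i
    using open_simplex_bounds[OF True that] by simp_all
  have "0 \<le> (\<Prod>i<length w. ff (w ! i) (t i))"
    by (intro prod_nonneg) (simp add: b ff_nonneg)
  moreover have "(\<Prod>i<length w. ennreal (ff (w ! i) (t i))) = ennreal (\<Prod>i<length w. ff (w ! i) (t i))"
    by (intro prod_ennreal) (simp add: b ff_nonneg)
  ultimately show ?thesis
    using True b[of 0] b[of "length w - 1"] assms by (simp add: ennreal_mult)
qed simp

lemma simplex_real_integrand_nonneg:
  assumes "w \<noteq> []"
  shows "0 \<le> indicator (open_simplex (length w)) t *
      ((1 - t 0) ^ m * (\<Prod>i<length w. ff (w ! i) (t i)) * t (length w - 1) ^ n)"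
proof (cases "t \<in> open_simplex (length w)")
  case True
  have b: "0 < t i" "t i < 1" if "i < length w" for i
    using open_simplex_bounds[OF True that] by simp_all
  have "0 \<le> (\<Prod>i<length w. ff (w ! i) (t i))"
    by (intro prod_nonneg) (simp add: b ff_nonneg)
  then show ?thesis
    using True b[of 0] b[of "length w - 1"] assms by simp
qed simp

text \<open>The integrand is nonnegative, and the conventions agree in the divergent case: the
  Bochner integral is then 0, as is \<open>enn2real\<close> of infinity.\<close>

lemma zeta_eq_simplex_int:
  assumes "w \<noteq> []"
  shows "zeta w m n = enn2real (simplex_int w (upper_weight m) (lower_weight n))"
proof -
  let ?M = "\<Pi>\<^sub>M i\<in>{..<length w}. (lborel :: real measure)"
  let ?R = "\<lambda>t. indicator (open_simplex (length w)) t *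
      ((1 - t 0) ^ m * (\<Prod>i<length w. ff (w ! i) (t i)) * t (length w - 1) ^ n)"
  have "(\<lambda>t. ennreal (?R t)) \<in> borel_measurable ?M"
    using simplex_integrand_measurable[of "upper_weight m" "lower_weight n" w] assms
    by (simp add: simplex_integrand_eq_ennreal)
  \<comment> \<open>Measurability of the real integrand is recovered from its \<open>ennreal\<close>
    version.\<close>
  then have "(\<lambda>t. enn2real (ennreal (?R t))) \<in> borel_measurable ?M"
    by measurable
  then have "?R \<in> borel_measurable ?M"
    by (simp only: enn2real_ennreal[OF simplex_real_integrand_nonneg[OF assms]])
  then have "integral\<^sup>L ?M ?R = enn2real (\<integral>\<^sup>+t. ennreal (?R t) \<partial>?M)"
    using simplex_real_integrand_nonneg[OF assms] by (intro integral_eq_nn_integral) auto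
  then show ?thesis
    using assms
    unfolding zeta_def simplex_int_def set_lebesgue_integral_def simplex_integrand_eq_ennreal[OF assms]
    by simp
qed

lemma zeta_Nil: "zeta [] m n = fact m * fact n / fact (m + n)"
  by (simp add: zeta_def)

section \<open>Beta integrals and words of one letter\<close>

lemma nn_integral_Beta:
  fixes a b :: real
  assumes "0 < a" "0 < b"
  shows "(\<integral>\<^sup>+y. ennreal (y powr (a - 1) * (1 - y) powr (b - 1)) * indicator {0<..<1} y \<partial>lborel) =
    ennreal (Beta a b)"
proof -
  have "((\<lambda>y. y powr (a - 1) * (1 - y) powr (b - 1)) has_integral Beta a b) {0<..<1}"
    using has_integral_Beta_real[OF assms] by (simp add: has_integral_Icc_iff_Ioo)
  then show ?thesis
    by (intro nn_integral_has_integral_lebesgue') auto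
qed

lemma nn_integral_Beta_nat:
  "(\<integral>\<^sup>+y. ennreal (y ^ a * (1 - y) ^ b) * indicator {0<..<1} y \<partial>lborel) =
    ennreal (fact a * fact b / fact (Suc (a + b)))"
proof -
  have "(\<integral>\<^sup>+y. ennreal (y ^ a * (1 - y) ^ b) * indicator {0<..<1} y \<partial>lborel) =
      (\<integral>\<^sup>+y. ennreal (y powr (real (Suc a) - 1) * (1 - y) powr (real (Suc b) - 1)) *
        indicator {0<..<1} y \<partial>lborel)"
    by (intro nn_integral_cong) (auto simp: indicator_def powr_realpow)
  also have "\<dots> = ennreal (Beta (real (Suc a)) (real (Suc b)))"
    by (intro nn_integral_Beta) auto
  also have "Beta (real (Suc a)) (real (Suc b)) = fact a * fact b / fact (Suc (a + b))"
    using Gamma_fact[of a, where 'a = real] Gamma_fact[of b, where 'a = real]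
      Gamma_fact[of "Suc (a + b)", where 'a = real]
    by (simp add: Beta_def add_ac)
  finally show ?thesis .
qed

text \<open>Since \<open>zeta []\<close> is given by a closed formula and not by an integral, the
  relations for the empty word need the explicit values of one-letter words.\<close>

lemma simplex_int_single_0:
  "simplex_int [0] (upper_weight m) (lower_weight (Suc n)) =
    ennreal (fact m * fact n / fact (Suc (m + n)))"
proof -
  have "simplex_int [0] (upper_weight m) (lower_weight (Suc n)) =
      (\<integral>\<^sup>+y. ennreal (y ^ n * (1 - y) ^ m) * indicator {0<..<1} y \<partial>lborel)"
    by (subst simplex_int_single)
       (auto simp: indicator_def ff_def ennreal_mult[symmetric] intro!: nn_integral_cong)
  then show ?thesis
    by (simp add: nn_integral_Beta_nat add.commute mult.commute[of "fact m"] del: fact_Suc power_Suc)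
qed

lemma zeta_single_0: "zeta [0] m (Suc n) = fact m * fact n / fact (Suc (m + n))"
  by (simp add: zeta_eq_simplex_int simplex_int_single_0 del: fact_Suc power_Suc)

lemma simplex_int_single_1:
  "simplex_int [1] (upper_weight (Suc m)) (lower_weight n) =
    ennreal (fact m * fact n / fact (Suc (m + n)))"
proof -
  have "simplex_int [1] (upper_weight (Suc m)) (lower_weight n) =
      (\<integral>\<^sup>+y. ennreal (y ^ n * (1 - y) ^ m) * indicator {0<..<1} y \<partial>lborel)"
    by (subst simplex_int_single)
       (auto simp: indicator_def ff_def ennreal_mult[symmetric] intro!: nn_integral_cong)
  then show ?thesis
    by (simp add: nn_integral_Beta_nat add.commute mult.commute[of "fact m"] del: fact_Suc power_Suc)
qed

lemma zeta_single_1: "zeta [1] (Suc m) n = fact m * fact n / fact (Suc (m + n))"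
  by (simp add: zeta_eq_simplex_int simplex_int_single_1 del: fact_Suc power_Suc)

section \<open>Finiteness for positive exponents\<close>

text \<open>Any positive power compensates the simple pole: the integral is
  \<open>Beta c (c + 1)\<close> or \<open>Beta (c + 1) c\<close>, according to the letter.\<close>

lemma nn_integral_ff_powr_finite:
  assumes "0 < c"
  shows "(\<integral>\<^sup>+y. ennreal (ff e y * (y powr c * (1 - y) powr c)) * indicator {0<..<1} y \<partial>lborel) < \<infinity>"
proof (cases e)
  case zero
  have "(\<integral>\<^sup>+y. ennreal (ff e y * (y powr c * (1 - y) powr c)) * indicator {0<..<1} y \<partial>lborel) =
      (\<integral>\<^sup>+y. ennreal (y powr (c - 1) * (1 - y) powr ((c + 1) - 1)) * indicator {0<..<1} y \<partial>lborel)"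
    using zero by (intro nn_integral_cong) (auto simp: indicator_def ff_def powr_diff)
  then show ?thesis
    using assms by (simp only: nn_integral_Beta) simp
next
  case one
  have "(\<integral>\<^sup>+y. ennreal (ff e y * (y powr c * (1 - y) powr c)) * indicator {0<..<1} y \<partial>lborel) =
      (\<integral>\<^sup>+y. ennreal (y powr ((c + 1) - 1) * (1 - y) powr (c - 1)) * indicator {0<..<1} y \<partial>lborel)"
    using one by (intro nn_integral_cong) (auto simp: indicator_def ff_def powr_diff)
  then show ?thesis
    using assms by (simp only: nn_integral_Beta) simp
qed

text \<open>As \<open>0 < x < 1\<close> and \<open>m\<close> is positive, \<open>x ^ m\<close> is at
  most \<open>x\<close>, the product of \<open>k\<close> copies of
  \<open>x powr (1 / k)\<close>.\<close>

lemma power_le_prod_powr: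
  fixes x :: real
  assumes "0 < x" "x < 1" "0 < k" "0 < m" "\<And>i. i < k \<Longrightarrow> x \<le> u i"
  shows "x ^ m \<le> (\<Prod>i<k. u i powr (1 / real k))"
proof -
  have "x ^ m \<le> x ^ 1"
    using assms by (intro power_decreasing) auto
  also have "x ^ 1 = (\<Prod>i<k. x powr (1 / real k))"
    using assms by (simp add: powr_realpow[symmetric] powr_powr)
  also have "\<dots> \<le> (\<Prod>i<k. u i powr (1 / real k))"
    using assms by (intro prod_mono) (auto intro: powr_mono2)
  finally show ?thesis .
qed

text \<open>On the simplex, \<open>1 - t\<^sub>1 \<le> 1 - t\<^sub>i\<close> and \<open>t\<^sub>k \<le> t\<^sub>i\<close>, so that the two weights can be shared out
  equally as \<open>((1 - t\<^sub>i) t\<^sub>i) powr (1 / k)\<close>; the integrand is then dominated by a product of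
  one-variable functions with finite Beta integrals.\<close>

lemma simplex_int_finite:
  assumes "w \<noteq> []" "0 < m" "0 < n"
  shows "simplex_int w (upper_weight m) (lower_weight n) < \<infinity>"
proof -
  interpret product_sigma_finite "\<lambda>_. lborel :: real measure"
    by (rule product_sigma_finite_lborel)
  let ?k = "length w"
  define c where "c = 1 / real ?k"
  define \<phi> where "\<phi> = (\<lambda>i y. ennreal (ff (w ! i) y * (y powr c * (1 - y) powr c)) *
      indicator {0<..<1} y)"
  have k: "0 < ?k" "0 < c"
    using assms(1) by (simp_all add: c_def)
  have "upper_weight m (t 0) * (\<Prod>i<?k. ennreal (ff (w ! i) (t i))) *
      lower_weight n (t (?k - 1)) * indicator (open_simplex ?k) t \<le> (\<Prod>i<?k. \<phi> i (t i))" for t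
  proof (cases "t \<in> open_simplex ?k")
    case True
    note b = open_simplex_bounds[OF True]
    have p: "0 \<le> (\<Prod>i<?k. ff (w ! i) (t i))"
      by (intro prod_nonneg) (simp add: b ff_nonneg)
    have "(1 - t 0) ^ m \<le> (\<Prod>i<?k. (1 - t i) powr c)" "t (?k - 1) ^ n \<le> (\<Prod>i<?k. t i powr c)"
      unfolding c_def using k b assms by (auto intro!: power_le_prod_powr)
    then have "(1 - t 0) ^ m * (\<Prod>i<?k. ff (w ! i) (t i)) * t (?k - 1) ^ n \<le>
        (\<Prod>i<?k. (1 - t i) powr c) * (\<Prod>i<?k. ff (w ! i) (t i)) * (\<Prod>i<?k. t i powr c)"
      using p b[of 0] b[of "?k - 1"] k by (intro mult_mono mult_nonneg_nonneg p prod_nonneg[where f = "\<lambda>i. _ i powr c"]) auto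
    also have "\<dots> = (\<Prod>i<?k. ff (w ! i) (t i) * (t i powr c * (1 - t i) powr c))"
      by (simp add: prod.distrib mult_ac)
    finally have "ennreal ((1 - t 0) ^ m * (\<Prod>i<?k. ff (w ! i) (t i)) * t (?k - 1) ^ n) \<le>
        ennreal (\<Prod>i<?k. ff (w ! i) (t i) * (t i powr c * (1 - t i) powr c))"
      by (rule ennreal_leI)
    also have "\<dots> = (\<Prod>i<?k. ennreal (ff (w ! i) (t i) * (t i powr c * (1 - t i) powr c)))"
      by (intro prod_ennreal[symmetric]) (simp add: b ff_nonneg)
    also have "\<dots> = (\<Prod>i<?k. \<phi> i (t i))"
      using b by (intro prod.cong) (auto simp: \<phi>_def)
    finally show ?thesis
      using True unfolding simplex_integrand_eq_ennreal[OF assms(1)] by simp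
  qed simp
  then have "simplex_int w (upper_weight m) (lower_weight n) \<le>
      (\<integral>\<^sup>+t. (\<Prod>i<?k. \<phi> i (t i)) \<partial>(\<Pi>\<^sub>M i\<in>{..<?k}. lborel))"
    unfolding simplex_int_def by (intro nn_integral_mono) simp
  also have "\<dots> = (\<Prod>i<?k. \<integral>\<^sup>+y. \<phi> i y \<partial>lborel)"
    unfolding \<phi>_def by (intro product_nn_integral_prod) auto
  also have "\<dots> < \<infinity>"
    using nn_integral_ff_powr_finite[OF k(2)]
    by (auto simp: \<phi>_def less_top[symmetric] ennreal_prod_eq_top)
  finally show ?thesis .
qed

section \<open>The four relations in [0, \<infinity>]\<close>

lemma simplex_int_snoc_0:
  assumes "w \<noteq> []"
  shows "simplex_int (w @ [0]) (upper_weight m) (lower_weight (Suc n)) =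
    ennreal (1 / Suc n) * simplex_int w (upper_weight m) (lower_weight (Suc n))"
proof -
  have "simplex_int (w @ [0]) (upper_weight m) (lower_weight (Suc n)) =
      simplex_int w (upper_weight m) (lower_int 0 (lower_weight (Suc n)))"
    using assms by (intro simplex_int_snoc) auto
  also have "\<dots> = simplex_int w (upper_weight m) (\<lambda>t. ennreal (1 / Suc n) * lower_weight (Suc n) t)"
    using assms by (intro simplex_int_cong lower_int_0_power) auto
  also have "\<dots> = ennreal (1 / Suc n) * simplex_int w (upper_weight m) (lower_weight (Suc n))"
    using assms by (intro simplex_int_cmult_right) auto
  finally show ?thesis .
qed

lemma simplex_int_snoc_1:
  assumes "w \<noteq> []"
  shows "simplex_int (w @ [1]) (upper_weight m) (lower_weight n) =
    simplex_int (w @ [1]) (upper_weight m) (lower_weight (Suc n)) +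
    ennreal (1 / Suc n) * simplex_int w (upper_weight m) (lower_weight (Suc n))"
proof -
  have "simplex_int (w @ [1]) (upper_weight m) (lower_weight n) =
      simplex_int w (upper_weight m) (lower_int 1 (lower_weight n))"
    using assms by (intro simplex_int_snoc) auto
  also have "\<dots> = simplex_int w (upper_weight m)
      (\<lambda>t. lower_int 1 (lower_weight (Suc n)) t + ennreal (1 / Suc n) * lower_weight (Suc n) t)"
    using assms by (intro simplex_int_cong lower_int_1_power) auto
  also have "\<dots> = simplex_int w (upper_weight m) (lower_int 1 (lower_weight (Suc n))) +
      ennreal (1 / Suc n) * simplex_int w (upper_weight m) (lower_weight (Suc n))"
    using assms by (intro simplex_int_add_right) auto
  also have "simplex_int w (upper_weight m) (lower_int 1 (lower_weight (Suc n))) =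
      simplex_int (w @ [1]) (upper_weight m) (lower_weight (Suc n))"
    using assms by (intro simplex_int_snoc[symmetric]) auto
  finally show ?thesis .
qed

lemma simplex_int_Cons_1:
  assumes "w \<noteq> []"
  shows "simplex_int (1 # w) (upper_weight (Suc m)) (lower_weight n) =
    ennreal (1 / Suc m) * simplex_int w (upper_weight (Suc m)) (lower_weight n)"
proof -
  have "simplex_int (1 # w) (upper_weight (Suc m)) (lower_weight n) =
      simplex_int w (upper_int 1 (upper_weight (Suc m))) (lower_weight n)"
    using assms by (intro simplex_int_Cons) auto
  also have "\<dots> = simplex_int w (\<lambda>t. ennreal (1 / Suc m) * upper_weight (Suc m) t) (lower_weight n)"
    using assms by (intro simplex_int_cong upper_int_1_power) auto
  also have "\<dots> = ennreal (1 / Suc m) * simplex_int w (upper_weight (Suc m)) (lower_weight n)"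
    using assms by (intro simplex_int_cmult_left) auto
  finally show ?thesis .
qed

lemma simplex_int_Cons_0:
  assumes "w \<noteq> []"
  shows "simplex_int (0 # w) (upper_weight m) (lower_weight n) =
    simplex_int (0 # w) (upper_weight (Suc m)) (lower_weight n) +
    ennreal (1 / Suc m) * simplex_int w (upper_weight (Suc m)) (lower_weight n)"
proof -
  have "simplex_int (0 # w) (upper_weight m) (lower_weight n) =
      simplex_int w (upper_int 0 (upper_weight m)) (lower_weight n)"
    using assms by (intro simplex_int_Cons) auto
  also have "\<dots> = simplex_int w
      (\<lambda>t. upper_int 0 (upper_weight (Suc m)) t + ennreal (1 / Suc m) * upper_weight (Suc m) t)
      (lower_weight n)"
    using assms by (intro simplex_int_cong upper_int_0_power) auto
  also have "\<dots> = simplex_int w (upper_int 0 (upper_weight (Suc m))) (lower_weight n) +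
      ennreal (1 / Suc m) * simplex_int w (upper_weight (Suc m)) (lower_weight n)"
    using assms by (intro simplex_int_add_left) auto
  also have "simplex_int w (upper_int 0 (upper_weight (Suc m))) (lower_weight n) =
      simplex_int (0 # w) (upper_weight (Suc m)) (lower_weight n)"
    using assms by (intro simplex_int_Cons[symmetric]) auto
  finally show ?thesis .
qed

section \<open>Finiteness when one exponent is 0\<close>

text \<open>For \<open>m = 0\<close> the word starts with 0, and \<open>simplex_int_Cons_0\<close>
  rewrites the integral through two integrals with \<open>m = 1\<close>. The word \<open>[0]\<close>
  leaves an empty remainder and is evaluated directly.\<close>

lemma simplex_int_finite_starting:
  assumes "w \<noteq> []" "0 < m \<or> w \<in> words_starting 0" "0 < n"
  shows "simplex_int w (upper_weight m) (lower_weight n) < \<infinity>"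
proof (cases "m = 0")
  case True
  with assms(1,2) obtain v where w: "w = 0 # v"
    by (cases w) (auto simp: words_starting_def)
  show ?thesis
  proof (cases "v = []")
    case True
    with w \<open>m = 0\<close> show ?thesis
      using simplex_int_single_0[of 0 "n - 1"] assms(3) by simp
  next
    case False
    have "simplex_int (0 # v) (upper_weight 0) (lower_weight n) =
        simplex_int (0 # v) (upper_weight 1) (lower_weight n) +
        ennreal 1 * simplex_int v (upper_weight 1) (lower_weight n)"
      using simplex_int_Cons_0[OF False, of 0 n] by simp
    also have "\<dots> < \<infinity>"
      using simplex_int_finite[of "0 # v" 1 n] simplex_int_finite[of v 1 n] False assms(3) by simp
    finally show ?thesis
      using w \<open>m = 0\<close> by simp
  qed
qed (use assms simplex_int_finite in simp)

lemma simplex_int_finite_ending: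
  assumes "w \<noteq> []" "0 < n \<or> w \<in> words_ending 1" "0 < m"
  shows "simplex_int w (upper_weight m) (lower_weight n) < \<infinity>"
proof (cases "n = 0")
  case True
  with assms(1,2) obtain v where w: "w = v @ [1]"
    by (cases w rule: rev_cases) (auto simp: words_ending_def)
  show ?thesis
  proof (cases "v = []")
    case True
    with w \<open>n = 0\<close> show ?thesis
      using simplex_int_single_1[of "m - 1" 0] assms(3) by simp
  next
    case False
    have "simplex_int (v @ [1]) (upper_weight m) (lower_weight 0) =
        simplex_int (v @ [1]) (upper_weight m) (lower_weight 1) +
        ennreal 1 * simplex_int v (upper_weight m) (lower_weight 1)"
      using simplex_int_snoc_1[OF False, of m 0] by simp
    also have "\<dots> < \<infinity>"
      using simplex_int_finite[of "v @ [1]" m 1] simplex_int_finite[of v m 1] False assms(3) by simp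
    finally show ?thesis
      using w \<open>n = 0\<close> by simp
  qed
qed (use assms simplex_int_finite in simp)

section \<open>The relations for real values\<close>

text \<open>\<open>enn2real\<close> is multiplicative on all of [0, \<infinity>], infinity being
  sent to 0, so the product relation transfers as it stands.\<close>

lemma zeta_snoc_0: "zeta (w @ [0]) m (Suc n) = inverse (real (Suc n)) * zeta w m (Suc n)"
proof (cases "w = []")
  case True
  then show ?thesis
    by (simp add: zeta_single_0 zeta_Nil fact_Suc[of n] del: fact_Suc of_nat_Suc)
next
  case False
  then show ?thesis
    by (simp add: zeta_eq_simplex_int simplex_int_snoc_0 enn2real_mult inverse_eq_divide
        del: power_Suc of_nat_Suc)
qed

lemma zeta_Cons_1: "zeta (1 # w) (Suc m) n = inverse (real (Suc m)) * zeta w (Suc m) n"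
proof (cases "w = []")
  case True
  then show ?thesis
    by (simp add: zeta_single_1 zeta_Nil fact_Suc[of m] del: fact_Suc of_nat_Suc)
next
  case False
  then show ?thesis
    by (simp add: zeta_eq_simplex_int simplex_int_Cons_1 enn2real_mult inverse_eq_divide
        del: power_Suc of_nat_Suc)
qed

text \<open>The additive relation for the empty word, resting on
  \<open>m + n + 2 = (m + 1) + (n + 1)\<close>. Exchanging \<open>m\<close> and \<open>n\<close>
  serves the mirrored relation.\<close>

lemma fact_quotient_split:
  "fact m * fact n / fact (Suc (m + n)) =
    (fact m * fact (Suc n) / fact (Suc (Suc (m + n))) +
     inverse (real (Suc n)) * (fact (Suc m) * fact (Suc n) / fact (Suc (Suc (m + n)))) :: real)"
proof -
  have "fact (Suc (Suc (m + n))) = (real (Suc m) + real (Suc n)) * fact (Suc (m + n))"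
    by (simp add: algebra_simps)
  then show ?thesis
    by (simp add: divide_simps del: fact_Suc) (simp add: algebra_simps)
qed

text \<open>Unlike products, sums pass through \<open>enn2real\<close> only when both terms are
  finite; the assumption on \<open>m\<close> and \<open>w\<close> supplies this through
  \<open>simplex_int_finite_starting\<close>.\<close>

lemma zeta_snoc_1:
  assumes "0 < m \<or> w \<in> words_starting 0"
  shows "zeta (w @ [1]) m n =
    zeta (w @ [1]) m (Suc n) + inverse (real (Suc n)) * zeta w m (Suc n)"
proof (cases "w = []")
  case True
  \<comment> \<open>The empty word starts with no letter, so the assumption forces
    \<open>m > 0\<close>.\<close>
  with assms obtain m' where "m = Suc m'"
    by (cases m) (auto simp: words_starting_def)
  with True show ?thesis
    using fact_quotient_split[of m' n] by (simp add: zeta_single_1 zeta_Nil del: fact_Suc of_nat_Suc)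
next
  case False
  have "0 < m \<or> w @ [1] \<in> words_starting 0"
    using assms False by (auto simp: words_starting_def)
  then show ?thesis
    using False simplex_int_finite_starting[of "w @ [1]" m "Suc n"]
      simplex_int_finite_starting[of w m "Suc n"] assms
    by (simp add: zeta_eq_simplex_int simplex_int_snoc_1[of w m n] enn2real_plus enn2real_mult
        ennreal_mult_less_top inverse_eq_divide del: power_Suc of_nat_Suc)
qed

lemma zeta_Cons_0:
  assumes "0 < n \<or> w \<in> words_ending 1"
  shows "zeta (0 # w) m n = zeta (0 # w) (Suc m) n + inverse (real (Suc m)) * zeta w (Suc m) n"
proof (cases "w = []")
  case True
  with assms obtain n' where "n = Suc n'"
    by (cases n) (auto simp: words_ending_def)
  with True show ?thesis
    using fact_quotient_split[of n' m]
    by (simp add: zeta_single_0 zeta_Nil add_ac mult_ac del: fact_Suc of_nat_Suc)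
next
  case False
  have "0 < n \<or> 0 # w \<in> words_ending 1"
    using assms False by (auto simp: words_ending_def)
  then show ?thesis
    using False simplex_int_finite_ending[of "0 # w" n "Suc m"]
      simplex_int_finite_ending[of w n "Suc m"] assms
    by (simp add: zeta_eq_simplex_int simplex_int_Cons_0[of w m n] enn2real_plus enn2real_mult
        ennreal_mult_less_top inverse_eq_divide del: power_Suc of_nat_Suc)
qed

theorem theorem4:
  fixes w :: binary_word and m n :: nat
  shows "(n \<ge> 1 \<longrightarrow>
            (m \<ge> 1 \<or> w \<notin> words_starting 1 \<longrightarrow>
               zeta (w @ [0]) m n = inverse (real n) * zeta w m n) \<and>
            (m \<ge> 1 \<or> w \<in> words_starting 0 \<longrightarrow>
               zeta (w @ [1]) m (n - 1) = zeta (w @ [1]) m n + inverse (real n) * zeta w m n)) \<and>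
         (m \<ge> 1 \<longrightarrow>
            (n \<ge> 1 \<or> w \<notin> words_ending 0 \<longrightarrow>
               zeta (1 # w) m n = inverse (real m) * zeta w m n) \<and>
            (n \<ge> 1 \<or> w \<in> words_ending 1 \<longrightarrow>
               zeta (0 # w) (m - 1) n = zeta (0 # w) m n + inverse (real m) * zeta w m n))"
proof (intro conjI impI)
  assume "n \<ge> 1"
  then obtain k where k: "n = Suc k"
    by (cases n) auto
  show "zeta (w @ [0]) m n = inverse (real n) * zeta w m n"
    unfolding k by (rule zeta_snoc_0)
  assume "m \<ge> 1 \<or> w \<in> words_starting 0"
  then show "zeta (w @ [1]) m (n - 1) = zeta (w @ [1]) m n + inverse (real n) * zeta w m n"
    unfolding k using zeta_snoc_1[of m w k] by auto
next
  assume "m \<ge> 1"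
  then obtain k where k: "m = Suc k"
    by (cases m) auto
  show "zeta (1 # w) m n = inverse (real m) * zeta w m n"
    unfolding k by (rule zeta_Cons_1)
  assume "n \<ge> 1 \<or> w \<in> words_ending 1"
  then show "zeta (0 # w) (m - 1) n = zeta (0 # w) m n + inverse (real m) * zeta w m n"
    unfolding k using zeta_Cons_0[of n w k] by auto
qed

end
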